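(* Let $\mathbb{H}$ be a finite-dimensional complex Hilbert space, fix $O_0=\{|e_n\rangle\langle e_n^*|\}_{n}\in\tilde{\mathcal{W}}(\mathbb{H})$, and let $\Omega$ be an $O_0$-connection. Let $C_W:[0,\tau]\ni t\mapsto O(t)\in\tilde{\mathcal{W}}(\mathbb{H})$ be a smooth curve relative to $O_0$. Then for every $V_0\in\mathcal{F}^{O(0)}_{O_0}$ there exists a unique horizontal $O_0$-lift $t\mapsto\tilde V(t)$ of $C_W$ with respect to $\Omega$ such that $\tilde V(0)=V_0$.
   Context: Let $d=\dim\mathbb{H}$. A complete decomposition is a set $\{|n\rangle\langle n^*|:1\le n\le d\}$ of rank-one operators with $\sum_n|n\rangle\langle n^*|=I$ and $\langle n^*|m\rangle=\delta_{nm}$; $\tilde{\mathcal{W}}(\mathbb{H})$ is the set of all complete decompositions. $\mathcal{T}(\mathbb{H})$ is the group of invertible operators on $\mathbb{H}$. For $O\in\tilde{\mathcal{W}}(\mathbb{H})$, $\mathcal{F}^O_{O_0}=\{V\in\mathcal{T}(\mathbb{H}):V^{-1}OV=O_0\}$ (where $V^{-1}OV=\{V^{-1}aV:a\in O\}$); these fibers partition $\mathcal{T}(\mathbb{H})$, and $\Pi(V)=O$ iff $V\in\mathcal{F}^O_{O_0}$. Let $\mathcal{G}_{O_0}=\{\sum_nc_n|e_{\sigma(n)}\rangle\langle e_n^*|:\sigma\text{ a permutation},c_n\in\mathbb{C}\setminus\{0\}\}$ and $\mathrm{g}_{O_0}=\{\sum_n\alpha_n|e_n\rangle\langle e_n^*|:\alpha_n\in\mathbb{C}\}$.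 For $P\in\mathcal{T}(\mathbb{H})$, a tangent vector at $P$ is any linear operator $Q$ on $\mathbb{H}$ (derivative at $0$ of a differentiable curve in $\mathcal{T}(\mathbb{H})$ through $P$); $Q$ is vertical if it is the derivative at $0$ of a differentiable curve in the fiber $\mathcal{F}^{\Pi(P)}_{O_0}$ through $P$. An $O_0$-connection is a family $\Omega=\{\Omega_P\}_{P\in\mathcal{T}(\mathbb{H})}$ of linear maps from the tangent space at $P$ into $\mathrm{g}_{O_0}$ such that (1) $\Omega_P(Q)=P^{-1}Q$ for every vertical $Q$ at $P$; (2) if $P_k\to P_0$ in $\mathcal{T}(\mathbb{H})$ and $Q_k\to Q_0$, then $\Omega_{P_k}(Q_k)\to\Omega_{P_0}(Q_0)$; (3) $\Omega_{PG}(QG)=G^{-1}\Omega_P(Q)G$ for all $G\in\mathcal{G}_{O_0}$, $P$, $Q$. An $O_0$-lift of a continuous curve $t\mapsto O(t)$ is a continuous curve $V:[0,\tau]\to\mathcal{T}(\mathbb{H})$ with $V(t)\in\mathcal{F}^{O(t)}_{O_0}$ for all $t$; it is smooth if it is continuously differentiable on $[0,\tau]$. The curve $C_W$ is smooth relative to $O_0$ if it admits a smooth $O_0$-lift. A horizontal $O_0$-lift with respect to $\Omega$ is a smooth $O_0$-lift $\tilde V$ with $\Omega_{\tilde V(t)}\big[\frac{d\tilde V(t)}{dt}\big]=0$ for all $t\in[0,\tau]$. *)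

theory Defs
  imports "HOL-Analysis.Analysis"
begin

text \<open>The Hilbert space H is modelled as complex^'n (standard inner product, 'n finite,
  d = CARD('n)); operators on H are matrices complex^'n^'n.\<close>

type_synonym 'n op = "complex^'n::finite^'n::finite"

text \<open>The rank-one operator |u><w| : x \<mapsto> <w|x> u.\<close>
definition ketbra :: "complex^'n::finite \<Rightarrow> complex^'n \<Rightarrow> 'n op" where
  "ketbra u w = (\<chi> i j. u$i * cnj (w$j))"

text \<open>The pairing <w|u> (conjugate-linear in w).\<close>
definition braket :: "complex^'n::finite \<Rightarrow> complex^'n \<Rightarrow> complex" where
  "braket w u = (\<Sum>i\<in>UNIV. cnj (w$i) * u$i)"

text \<open>Complex scalar multiplication of operators.\<close>
definition cscale :: "complex \<Rightarrow> ('n::finite) op \<Rightarrow> 'n op" where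
  "cscale c M = (\<chi> i j. c * M$i$j)"

text \<open>(e, es) is a biorthogonal family giving a complete decomposition.\<close>
definition is_cd_family :: "('n::finite \<Rightarrow> complex^'n) \<Rightarrow> ('n \<Rightarrow> complex^'n) \<Rightarrow> bool" where
  "is_cd_family e es \<longleftrightarrow>
     (\<Sum>k\<in>UNIV. ketbra (e k) (es k)) = mat 1 \<and>
     (\<forall>k l. braket (es k) (e l) = (if k = l then 1 else 0))"

text \<open>The set \<tilde>W(H) of complete decompositions.\<close>
definition complete_decomps :: "('n::finite) op set set" where
  "complete_decomps = {Oc. \<exists>e es. is_cd_family e es \<and> Oc = range (\<lambda>k. ketbra (e k) (es k))}"

text \<open>T(H): invertible operators.\<close>
definition invops :: "('n::finite) op set" where
  "invops = {V. invertible V}"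

text \<open>The fiber F^O_{O0} = {V \<in> T(H). V^{-1} Oc V = O0}.\<close>
definition fiber :: "('n::finite) op set \<Rightarrow> 'n op set \<Rightarrow> 'n op set" where
  "fiber Oc O0 = {V. invertible V \<and> (\<lambda>a. matrix_inv V ** a ** V) ` Oc = O0}"

text \<open>The group G_{O0} and the algebra g_{O0}, relative to O0 = {|e_n><e_n^*|}.\<close>
definition GO :: "('n::finite \<Rightarrow> complex^'n) \<Rightarrow> ('n \<Rightarrow> complex^'n) \<Rightarrow> 'n op set" where
  "GO e es = {(\<Sum>k\<in>UNIV. cscale (c k) (ketbra (e (\<sigma> k)) (es k))) | \<sigma> c.
               \<sigma> permutes (UNIV::'n set) \<and> (\<forall>k. c k \<noteq> 0)}"

definition gO :: "('n::finite \<Rightarrow> complex^'n) \<Rightarrow> ('n \<Rightarrow> complex^'n) \<Rightarrow> 'n op set" where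
  "gO e es = {(\<Sum>k\<in>UNIV. cscale (\<alpha> k) (ketbra (e k) (es k))) | \<alpha>. True}"

text \<open>Q is a vertical tangent vector at P: derivative at 0 of a differentiable curve
  lying in the fiber of P (i.e. the fiber over \<Pi>(P)) and passing through P at time 0.\<close>
definition vertical :: "('n::finite) op set \<Rightarrow> 'n op \<Rightarrow> 'n op \<Rightarrow> bool" where
  "vertical O0 P Q \<longleftrightarrow>
     (\<exists>c \<epsilon> Oc. \<epsilon> > 0 \<and> P \<in> fiber Oc O0 \<and> c 0 = P \<and>
        (\<forall>t\<in>{-\<epsilon><..<\<epsilon>}. c t \<in> fiber Oc O0) \<and>
        (c has_vector_derivative Q) (at 0))"

text \<open>O0-connection (O0 given by the family e, es).\<close>
definition is_connection ::
  "('n::finite \<Rightarrow> complex^'n) \<Rightarrow> ('n \<Rightarrow> complex^'n) \<Rightarrow> ('n op \<Rightarrow> 'n op \<Rightarrow> 'n op) \<Rightarrow> bool" where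
  "is_connection e es \<Omega> \<longleftrightarrow>
     (\<forall>P\<in>invops. \<forall>Q. \<Omega> P Q \<in> gO e es) \<and>
     (\<forall>P\<in>invops. \<forall>Q R. \<Omega> P (Q + R) = \<Omega> P Q + \<Omega> P R) \<and>
     (\<forall>P\<in>invops. \<forall>c Q. \<Omega> P (cscale c Q) = cscale c (\<Omega> P Q)) \<and>
     (\<forall>P\<in>invops. \<forall>Q. vertical (range (\<lambda>k. ketbra (e k) (es k))) P Q
         \<longrightarrow> \<Omega> P Q = matrix_inv P ** Q) \<and>
     (\<forall>Ps Qs P0 Q0. (\<forall>k. Ps k \<in> invops) \<and> P0 \<in> invops \<and>
         Ps \<longlonglongrightarrow> P0 \<and> Qs \<longlonglongrightarrow> Q0 \<longrightarrow>
         (\<lambda>k. \<Omega> (Ps k) (Qs k)) \<longlonglongrightarrow> \<Omega> P0 Q0) \<and>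
     (\<forall>G\<in>GO e es. \<forall>P\<in>invops. \<forall>Q.
         \<Omega> (P ** G) (Q ** G) = matrix_inv G ** \<Omega> P Q ** G)"

text \<open>O0-lift of the curve Oc on [0,\<tau>].\<close>
definition is_lift :: "'n op set \<Rightarrow> real \<Rightarrow> (real \<Rightarrow> ('n::finite) op set) \<Rightarrow> (real \<Rightarrow> 'n op) \<Rightarrow> bool" where
  "is_lift O0 \<tau> Oc V \<longleftrightarrow> continuous_on {0..\<tau>} V \<and> (\<forall>t\<in>{0..\<tau>}. V t \<in> fiber (Oc t) O0)"

text \<open>Smooth lift: continuously differentiable on [0,\<tau>] (one-sided at the end points).\<close>
definition is_smooth_lift :: "'n op set \<Rightarrow> real \<Rightarrow> (real \<Rightarrow> ('n::finite) op set) \<Rightarrow> (real \<Rightarrow> 'n op) \<Rightarrow> bool" where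
  "is_smooth_lift O0 \<tau> Oc V \<longleftrightarrow> is_lift O0 \<tau> Oc V \<and>
     (\<exists>V'. (\<forall>t\<in>{0..\<tau>}. (V has_vector_derivative V' t) (at t within {0..\<tau>})) \<and>
           continuous_on {0..\<tau>} V')"

definition is_horizontal_lift ::
  "('n::finite \<Rightarrow> complex^'n) \<Rightarrow> ('n \<Rightarrow> complex^'n) \<Rightarrow> ('n op \<Rightarrow> 'n op \<Rightarrow> 'n op) \<Rightarrow>
   real \<Rightarrow> (real \<Rightarrow> 'n op set) \<Rightarrow> (real \<Rightarrow> 'n op) \<Rightarrow> bool" where
  "is_horizontal_lift e es \<Omega> \<tau> Oc V \<longleftrightarrow>
     is_smooth_lift (range (\<lambda>k. ketbra (e k) (es k))) \<tau> Oc V \<and>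
     (\<forall>t\<in>{0..\<tau>}. \<Omega> (V t) (vector_derivative V (at t within {0..\<tau>})) = 0)"

end

theory Submission
  imports Defs
begin

(* In coordinates adapted to the basis e_n, O0 becomes the set of diagonal matrix units, so
   G_O0 (its stabiliser under conjugation) is the group of invertible monomial matrices and g_O0
   the algebra of diagonal matrices. Equivariance and the vertical axiom give the gauge rule
     Omega(V G, V G' + V' G) = G^-1 G' + G^-1 Omega(V, V') G      for G in G_O0.
   Existence: for any smooth lift V write Omega(V, V') = diag(alpha); the monomial matrix G(t) with
   entry c_k exp(- integral_0^t alpha_(sigma k)) at (sigma k, k) has G^-1 G' = - diag(alpha o sigma)
   = - G^-1 diag(alpha) G, so V G is horizontal, and sigma, c are fixed by V(0) G(0) = V0.
   Uniqueness: for horizontal lifts V, W the quotient H = V^-1 W is G_O0-valued, so V H' is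
   vertical, and the gauge rule gives H^-1 H' = 0; hence H is constantly 1. *)

section \<open>Matrix-valued curves and matrix inversion\<close>

lemma bounded_bilinear_matrix_mult:
  "bounded_bilinear ((**) :: 'a::{euclidean_space,real_normed_algebra_1}^'n::finite^'m::finite
                              \<Rightarrow> 'a^'k::finite^'n \<Rightarrow> 'a^'k^'m)"
  unfolding bilinear_conv_bounded_bilinear[symmetric] bilinear_def
  by (auto intro!: linearI simp: vec_eq_iff matrix_matrix_mult_def sum.distrib scaleR_sum_right
      distrib_left distrib_right)

lemmas has_vector_derivative_matrix_mult =
  bounded_bilinear.has_vector_derivative[OF bounded_bilinear_matrix_mult]

lemmas continuous_on_matrix_mult =
  bounded_bilinear.continuous_on[OF bounded_bilinear_matrix_mult]

lemma matrix_mult_diff_left: "(A - B) ** C = A ** C - B ** (C :: 'a::ring_1^'k^'n)"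
  by (simp add: matrix_matrix_mult_def vec_eq_iff sum_subtractf left_diff_distrib)

lemma matrix_mult_diff_right: "A ** (B - C) = A ** B - A ** (C :: 'a::ring_1^'k^'n)"
  by (simp add: matrix_matrix_mult_def vec_eq_iff sum_subtractf right_diff_distrib)

lemma matrix_inv_right: "invertible A \<Longrightarrow> A ** matrix_inv A = mat 1"
  and matrix_inv_left: "invertible A \<Longrightarrow> matrix_inv A ** A = mat 1"
  unfolding invertible_def matrix_inv_def by (metis (mono_tags, lifting) someI)+

lemma matrix_inv_unique:
  fixes A :: "'a::field^'n::finite^'n"
  assumes "A ** B = mat 1"
  shows "matrix_inv A = B"
proof -
  have "invertible A" using assms invertible_right_inverse by blast
  hence "matrix_inv A = matrix_inv A ** (A ** B)" using assms by simp
  also have "\<dots> = B" using \<open>invertible A\<close> by (simp add: matrix_mul_assoc matrix_inv_left)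
  finally show ?thesis .
qed

lemma invertible_matrix_inv: "invertible A \<Longrightarrow> invertible (matrix_inv A)"
  using matrix_inv_left matrix_inv_right invertible_def by blast

lemma matrix_inv_mult:
  fixes A B :: "'a::field^'n::finite^'n"
  assumes "invertible A" "invertible B"
  shows "matrix_inv (A ** B) = matrix_inv B ** matrix_inv A"
  by (rule matrix_inv_unique) (metis assms matrix_mul_assoc matrix_mul_rid matrix_inv_right)

lemma matrix_inv_diff:
  fixes X Y :: "'a::field^'n::finite^'n"
  assumes "invertible X" "invertible Y"
  shows "matrix_inv Y - matrix_inv X = - (matrix_inv Y ** (Y - X) ** matrix_inv X)"
proof -
  have "matrix_inv Y ** (Y - X) ** matrix_inv X
      = matrix_inv Y ** Y ** matrix_inv X - matrix_inv Y ** (X ** matrix_inv X)"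
    by (simp add: matrix_mult_diff_left matrix_mult_diff_right matrix_mul_assoc)
  thus ?thesis using assms by (simp add: matrix_inv_left matrix_inv_right)
qed

lemma matrix_inv_cramer:
  fixes A :: "'a::field^'n::finite^'n"
  assumes "invertible A"
  shows "matrix_inv A = (\<chi> i j. det (\<chi> r c. if c = i then of_bool (r = j) else A$r$c) / det A)"
proof -
  have "matrix_inv A $ i $ j = det (\<chi> r c. if c = i then of_bool (r = j) else A$r$c) / det A" for i j
  proof -
    define b :: "'a^'n" where "b = (\<chi> r. of_bool (r = j))"
    have "A *v (matrix_inv A *v b) = b"
      by (simp add: matrix_vector_mul_assoc matrix_inv_right[OF assms])
    hence "matrix_inv A *v b = (\<chi> k. det (\<chi> r c. if c = k then b $ r else A$r$c) / det A)"
      using cramer assms invertible_det_nz by blast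
    moreover have "(matrix_inv A *v b) $ i = matrix_inv A $ i $ j"
      by (simp add: matrix_vector_mult_def b_def of_bool_def if_distrib cong: if_cong)
    ultimately show ?thesis by (simp only: b_def vec_lambda_beta)
  qed
  thus ?thesis by (simp add: vec_eq_iff)
qed

lemma continuous_on_det [continuous_intros]:
  fixes F :: "'b::topological_space \<Rightarrow> 'a::real_normed_field^'n::finite^'n"
  shows "continuous_on S F \<Longrightarrow> continuous_on S (\<lambda>x. det (F x))"
  unfolding det_def by (intro continuous_intros)

lemma open_invertible: "open {A :: 'a::real_normed_field^'n::finite^'n. invertible A}"
proof -
  have "open ((\<lambda>A :: 'a^'n^'n. det A) -` (- {0}))"
    by (intro open_vimage continuous_on_det continuous_on_id) auto
  thus ?thesis by (simp add: vimage_def invertible_det_nz)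
qed

lemma continuous_on_matrix_inv:
  "continuous_on {A :: 'a::real_normed_field^'n::finite^'n. invertible A} matrix_inv"
proof (rule continuous_on_eq)
  have entry: "continuous_on S (\<lambda>A :: 'a^'n^'n. if c = i then z else A $ r $ c)" for S c i z r
    by (cases "c = i") (auto intro: continuous_on_component[OF continuous_on_component[OF continuous_on_id]])
  show "continuous_on {A. invertible A}
      (\<lambda>A :: 'a^'n^'n. \<chi> i j. det (\<chi> r c. if c = i then of_bool (r = j) else A$r$c) / det A)"
    by (intro continuous_intros entry) (auto simp: invertible_det_nz)
qed (simp add: matrix_inv_cramer)

lemma isCont_matrix_inv:
  fixes A :: "'a::real_normed_field^'n::finite^'n"
  shows "invertible A \<Longrightarrow> isCont matrix_inv A"
  using continuous_on_matrix_inv open_invertible continuous_on_eq_continuous_at by blast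

lemma has_derivative_matrix_inv:
  fixes X :: "'a::{real_normed_field,euclidean_space}^'n::finite^'n"
  assumes X: "invertible X"
  shows "(matrix_inv has_derivative (\<lambda>H. - (matrix_inv X ** H ** matrix_inv X))) (at X within S)"
proof -
  obtain K where "K > 0" and K: "\<And>(A :: 'a^'n^'n) (B :: 'a^'n^'n). norm (A ** B) \<le> norm A * norm B * K"
    using bounded_bilinear.pos_bounded[OF bounded_bilinear_matrix_mult] by blast
  obtain r where r: "r > 0" "ball X r \<subseteq> {A. invertible A}"
    using open_contains_ball_eq[OF open_invertible, of X] X by auto
  let ?H = "\<lambda>Y. norm (matrix_inv Y - matrix_inv X) * norm (matrix_inv X) * K * K"
  show ?thesis
  proof (rule has_derivativeI_sandwich[where e=r and H="?H"])
    show "bounded_linear (\<lambda>H. - (matrix_inv X ** H ** matrix_inv X))"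
      by (intro bounded_linear_minus bounded_linear_compose[OF
            bounded_bilinear.bounded_linear_left bounded_bilinear.bounded_linear_right]
            bounded_bilinear_matrix_mult)
  next
    fix Y assume Y: "Y \<in> S" "Y \<noteq> X" "dist Y X < r"
    hence "invertible Y" using r by (auto simp: dist_commute)
    hence "matrix_inv Y - matrix_inv X = - (matrix_inv Y ** (Y - X) ** matrix_inv X)"
      by (rule matrix_inv_diff[OF X])
    hence remainder: "matrix_inv Y - matrix_inv X - - (matrix_inv X ** (Y - X) ** matrix_inv X)
        = - ((matrix_inv Y - matrix_inv X) ** (Y - X) ** matrix_inv X)"
      unfolding matrix_mult_diff_left by simp
    have "norm ((matrix_inv Y - matrix_inv X) ** (Y - X) ** matrix_inv X)
        \<le> norm ((matrix_inv Y - matrix_inv X) ** (Y - X)) * norm (matrix_inv X) * K"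
      by (rule K)
    also have "\<dots> \<le> (norm (matrix_inv Y - matrix_inv X) * norm (Y - X) * K) * norm (matrix_inv X) * K"
      using K \<open>K > 0\<close> by (intro mult_right_mono) auto
    also have "\<dots> = ?H Y * norm (Y - X)"
      by (simp add: ac_simps)
    finally show "norm (matrix_inv Y - matrix_inv X - - (matrix_inv X ** (Y - X) ** matrix_inv X))
        / norm (Y - X) \<le> ?H Y"
      using Y unfolding remainder norm_minus_cancel by (simp add: divide_le_eq)
  next
    have "(matrix_inv \<longlongrightarrow> matrix_inv X) (at X within S)"
      using isCont_matrix_inv[OF X] unfolding isCont_def by (rule tendsto_within_subset) simp
    hence "((\<lambda>Y. norm (matrix_inv Y - matrix_inv X)) \<longlongrightarrow> 0) (at X within S)"
      by (simp add: LIM_zero_iff tendsto_norm_zero)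
    thus "(?H \<longlongrightarrow> 0) (at X within S)"
      by (intro tendsto_mult_left_zero)
  qed (use r in simp)
qed

lemma has_vector_derivative_matrix_inv:
  fixes V :: "real \<Rightarrow> 'a::{real_normed_field,euclidean_space}^'n::finite^'n"
  assumes "(V has_vector_derivative V') (at t within S)" "invertible (V t)"
  shows "((\<lambda>s. matrix_inv (V s)) has_vector_derivative - (matrix_inv (V t) ** V' ** matrix_inv (V t)))
           (at t within S)"
  using has_derivative_compose[OF assms(1)[unfolded has_vector_derivative_def]
      has_derivative_matrix_inv[OF assms(2)]]
  by (simp add: has_vector_derivative_def bounded_bilinear.scaleR_left[OF bounded_bilinear_matrix_mult]
      bounded_bilinear.scaleR_right[OF bounded_bilinear_matrix_mult])

lemma bounded_linear_axis: "bounded_linear (axis i :: 'a::real_normed_vector \<Rightarrow> 'a^'n::finite)"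
proof (rule bounded_linear_intro[where K=1])
  show "norm (axis i x :: 'a^'n) \<le> norm x * 1" for x
  proof -
    have "(\<Sum>j\<in>UNIV. (norm ((axis i x :: 'a^'n) $ j))\<^sup>2) = (\<Sum>j\<in>UNIV. if j = i then (norm x)\<^sup>2 else 0)"
      by (rule sum.cong) (auto simp: axis_def)
    thus ?thesis by (simp add: norm_vec_def L2_set_def)
  qed
qed (auto simp: axis_def vec_eq_iff)

lemma has_vector_derivative_vec_lambda:
  fixes f :: "real \<Rightarrow> 'i::finite \<Rightarrow> 'a::real_normed_vector"
  assumes "\<And>i. ((\<lambda>x. f x i) has_vector_derivative f' i) F"
  shows "((\<lambda>x. \<chi> i. f x i) has_vector_derivative (\<chi> i. f' i)) F"
proof -
  have sum: "(\<chi> i. g i) = (\<Sum>i\<in>UNIV. axis i (g i))" for g :: "'i \<Rightarrow> 'a"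
    by (simp add: vec_eq_iff axis_def)
  show ?thesis
    unfolding sum
    by (intro has_vector_derivative_sum bounded_linear.has_vector_derivative[OF bounded_linear_axis] assms)
qed

lemma has_vector_derivative_shift_at_0:
  assumes "(f has_vector_derivative f') (at t within {a..b})" and t: "t \<in> {a<..<b}"
  shows "((\<lambda>s. f (t + s)) has_vector_derivative f') (at 0)"
proof -
  have "(f has_vector_derivative f') (at t within {a<..<b})"
    by (rule has_vector_derivative_within_subset[OF assms(1)]) auto
  hence "(f has_vector_derivative f') (at t)"
    by (rule has_vector_derivative_within_open[OF t open_greaterThanLessThan, THEN iffD1])
  moreover have "((\<lambda>s. t + s) has_vector_derivative 1) (at 0)"
    by (auto intro!: derivative_eq_intros)
  ultimately show ?thesis
    using vector_diff_chain_at[of "\<lambda>s. t + s" 1 0 f f'] by (simp add: o_def)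
qed

lemma has_vector_derivative_exp_integral:
  fixes a :: "real \<Rightarrow> 'a::{real_normed_field,banach}"
  assumes a: "continuous_on {0..\<tau>} a" and t: "t \<in> {0..\<tau>}"
  shows "((\<lambda>t. c * exp (integral {0..t} a)) has_vector_derivative a t * (c * exp (integral {0..t} a)))
           (at t within {0..\<tau>})"
proof -
  have "((\<lambda>t. integral {0..t} a) has_vector_derivative a t) (at t within {0..\<tau>})"
    by (rule integral_has_vector_derivative[OF a t])
  moreover have "(exp has_field_derivative exp (integral {0..t} a)) (at (integral {0..t} a) within X)" for X
    by (rule has_field_derivative_at_within) (rule DERIV_exp)
  ultimately have "((\<lambda>t. exp (integral {0..t} a)) has_vector_derivative a t * exp (integral {0..t} a))
      (at t within {0..\<tau>})"
    using field_vector_diff_chain_within by (force simp: o_def)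
  thus ?thesis
    using has_vector_derivative_mult_right by (force simp: ac_simps)
qed

section \<open>Monomial matrices\<close>

definition monomial_matrix :: "('n::finite \<Rightarrow> 'n) \<Rightarrow> ('n \<Rightarrow> 'a::zero) \<Rightarrow> 'a^'n^'n" where
  "monomial_matrix \<sigma> g = (\<chi> i j. if i = \<sigma> j then g j else 0)"

abbreviation diagonal_matrix :: "('n::finite \<Rightarrow> 'a::zero) \<Rightarrow> 'a^'n^'n" where
  "diagonal_matrix \<equiv> monomial_matrix id"

lemma matrix_mult_monomial_matrix_nth:
  "(N ** monomial_matrix \<sigma> g) $ i $ j = N $ i $ \<sigma> j * (g j :: 'a::semiring_1)"
proof -
  have "(\<Sum>k\<in>UNIV. N $ i $ k * (if k = \<sigma> j then g j else 0)) = N $ i $ \<sigma> j * g j"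
    by (simp add: if_distrib[of "\<lambda>x. N $ i $ _ * x"] cong: if_cong)
  thus ?thesis by (simp add: matrix_matrix_mult_def monomial_matrix_def)
qed

lemma diagonal_matrix_mult_nth:
  "(diagonal_matrix g ** N) $ i $ j = (g i :: 'a::semiring_1) * N $ i $ j"
proof -
  have "(\<Sum>k\<in>UNIV. (if i = k then g k else 0) * N $ k $ j) = g i * N $ i $ j"
    by (simp add: if_distrib[of "\<lambda>x. x * N $ _ $ j"] cong: if_cong)
  thus ?thesis by (simp add: matrix_matrix_mult_def monomial_matrix_def)
qed

lemma monomial_matrix_mult:
  "monomial_matrix \<sigma> g ** monomial_matrix \<tau> h = monomial_matrix (\<sigma> \<circ> \<tau>) (\<lambda>j. g (\<tau> j) * (h j :: 'a::semiring_1))"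
  by (simp add: vec_eq_iff matrix_mult_monomial_matrix_nth) (simp add: monomial_matrix_def)

lemma diagonal_matrix_one: "diagonal_matrix (\<lambda>_. 1) = mat 1"
  by (simp add: monomial_matrix_def mat_def vec_eq_iff)

lemma monomial_matrix_add:
  "monomial_matrix \<sigma> g + monomial_matrix \<sigma> h = monomial_matrix \<sigma> (\<lambda>j. g j + (h j :: 'a::monoid_add))"
  by (simp add: monomial_matrix_def vec_eq_iff)

lemma monomial_matrix_zero: "monomial_matrix \<sigma> (\<lambda>_. 0) = 0"
  by (simp add: monomial_matrix_def vec_eq_iff)

lemma monomial_matrix_inverse:
  fixes g :: "'n::finite \<Rightarrow> 'a::field"
  assumes "\<sigma> permutes UNIV" "\<forall>k. g k \<noteq> 0"
  shows "monomial_matrix \<sigma> g ** monomial_matrix (inv \<sigma>) (\<lambda>j. inverse (g (inv \<sigma> j))) = mat 1"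
  using assms
  by (simp add: monomial_matrix_mult permutes_inv_o flip: diagonal_matrix_one)

lemma invertible_monomial_matrix:
  fixes g :: "'n::finite \<Rightarrow> 'a::field"
  shows "\<sigma> permutes UNIV \<Longrightarrow> \<forall>k. g k \<noteq> 0 \<Longrightarrow> invertible (monomial_matrix \<sigma> g)"
  using monomial_matrix_inverse invertible_right_inverse by blast

lemma matrix_inv_monomial_matrix:
  fixes g :: "'n::finite \<Rightarrow> 'a::field"
  shows "\<sigma> permutes UNIV \<Longrightarrow> \<forall>k. g k \<noteq> 0 \<Longrightarrow>
    matrix_inv (monomial_matrix \<sigma> g) = monomial_matrix (inv \<sigma>) (\<lambda>j. inverse (g (inv \<sigma> j)))"
  by (rule matrix_inv_unique) (rule monomial_matrix_inverse)

lemma monomial_matrix_conj_diagonal: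
  fixes g :: "'n::finite \<Rightarrow> 'a::field"
  assumes \<sigma>: "\<sigma> permutes UNIV" and "\<forall>k. g k \<noteq> 0"
  shows "matrix_inv (monomial_matrix \<sigma> g) ** diagonal_matrix \<alpha> ** monomial_matrix \<sigma> g
       = diagonal_matrix (\<alpha> \<circ> \<sigma>)"
proof -
  have "(\<lambda>j. inverse (g j) * \<alpha> (\<sigma> j) * g j) = \<alpha> \<circ> \<sigma>"
    using assms(2) by (simp add: fun_eq_iff)
  thus ?thesis
    using assms by (simp add: matrix_inv_monomial_matrix monomial_matrix_mult permutes_inv_o permutes_inverses
        flip: id_def)
qed

lemma has_vector_derivative_monomial_matrix:
  fixes g :: "'n::finite \<Rightarrow> real \<Rightarrow> 'a::real_normed_vector"
  assumes "\<And>k. (g k has_vector_derivative g' k) F"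
  shows "((\<lambda>t. monomial_matrix \<sigma> (\<lambda>k. g k t)) has_vector_derivative monomial_matrix \<sigma> g') F"
  unfolding monomial_matrix_def
  by (intro has_vector_derivative_vec_lambda) (auto intro: assms)

lemma continuous_on_monomial_matrix:
  fixes g :: "'n::finite \<Rightarrow> real \<Rightarrow> 'a::real_normed_vector"
  assumes "\<And>k. continuous_on S (g k)"
  shows "continuous_on S (\<lambda>t. monomial_matrix \<sigma> (\<lambda>k. g k t))"
  unfolding monomial_matrix_def
proof (intro continuous_on_vec_lambda)
  show "continuous_on S (\<lambda>t. if i = \<sigma> j then g j t else 0)" for i j
    using assms by (cases "i = \<sigma> j") auto
qed

definition conj_stabilizer :: "('a::semiring_1^'n::finite^'n) set \<Rightarrow> ('a^'n^'n) set" where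
  "conj_stabilizer S = {M. invertible M \<and> (\<lambda>a. matrix_inv M ** a ** M) ` S = S}"

abbreviation diagonal_unit :: "'n::finite \<Rightarrow> 'a::zero_neq_one^'n^'n" where
  "diagonal_unit k \<equiv> diagonal_matrix (\<lambda>j. of_bool (j = k))"

lemma monomial_matrix_in_conj_stabilizer:
  fixes c :: "'n::finite \<Rightarrow> 'a::field"
  assumes \<sigma>: "\<sigma> permutes UNIV" and c: "\<forall>k. c k \<noteq> 0"
  shows "monomial_matrix \<sigma> c \<in> conj_stabilizer (range diagonal_unit)"
proof -
  have "(\<lambda>j. of_bool (j = k) :: 'a) \<circ> \<sigma> = (\<lambda>j. of_bool (j = inv \<sigma> k))" for k
    using \<sigma> by (auto simp: fun_eq_iff permutes_inverses)
  hence "(\<lambda>a. matrix_inv (monomial_matrix \<sigma> c) ** a ** monomial_matrix \<sigma> c) ` range diagonal_unit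
      = diagonal_unit ` range (inv \<sigma>)"
    by (simp add: monomial_matrix_conj_diagonal[OF \<sigma> c] image_image)
  also have "\<dots> = range diagonal_unit"
    using permutes_surj[OF permutes_inv[OF \<sigma>]] by simp
  finally show ?thesis
    unfolding conj_stabilizer_def using invertible_monomial_matrix[OF \<sigma> c] by blast
qed

lemma invertible_nonzero_column:
  fixes N :: "'a::semiring_1^'n::finite^'n"
  assumes "invertible N"
  obtains r where "N $ r $ j \<noteq> 0"
proof -
  have "(matrix_inv N ** N) $ j $ j = 1"
    using matrix_inv_left[OF assms] by (simp add: mat_def)
  hence "\<exists>r. N $ r $ j \<noteq> 0"
    by (rule contrapos_pp) (simp add: matrix_matrix_mult_def)
  thus thesis using that by blast
qed

lemma conj_stabilizer_diagonal_units_monomial: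
  fixes N :: "'a::field^'n::finite^'n"
  assumes "N \<in> conj_stabilizer (range diagonal_unit)"
  obtains \<sigma> c where "\<sigma> permutes UNIV" "\<forall>k. c k \<noteq> 0" "N = monomial_matrix \<sigma> c"
proof -
  have N: "invertible N" and img: "(\<lambda>a. matrix_inv N ** a ** N) ` range diagonal_unit = range diagonal_unit"
    using assms unfolding conj_stabilizer_def by auto
  have "\<forall>k. \<exists>m. matrix_inv N ** diagonal_unit k ** N = diagonal_unit m"
    using img by blast
  then obtain \<pi> where \<pi>: "\<And>k. matrix_inv N ** diagonal_unit k ** N = diagonal_unit (\<pi> k)"
    by metis
  have column: "N $ r $ \<pi> k = 0" if "r \<noteq> k" for r k
  proof -
    have "diagonal_unit k ** N = N ** (matrix_inv N ** diagonal_unit k ** N)"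
      by (simp add: matrix_mul_assoc matrix_inv_right[OF N])
    hence "diagonal_unit k ** N = N ** diagonal_unit (\<pi> k)"
      by (simp only: \<pi>)
    hence "(diagonal_unit k ** N) $ r $ \<pi> k = (N ** diagonal_unit (\<pi> k)) $ r $ \<pi> k"
      by simp
    thus ?thesis using that by (simp add: diagonal_matrix_mult_nth matrix_mult_monomial_matrix_nth)
  qed
  have "inj \<pi>"
  proof (rule injI)
    fix k l assume "\<pi> k = \<pi> l"
    obtain r where r: "N $ r $ \<pi> k \<noteq> 0" using invertible_nonzero_column[OF N] .
    hence "r = k" using column by blast
    moreover have "r = l" using r column \<open>\<pi> k = \<pi> l\<close> by metis
    ultimately show "k = l" by simp
  qed
  hence \<pi>: "\<pi> permutes UNIV"
    using finite_UNIV_inj_surj[of \<pi>] by (auto intro: bij_imp_permutes simp: bij_betw_def)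
  define c where "c j = N $ inv \<pi> j $ j" for j
  have N_eq: "N = monomial_matrix (inv \<pi>) c"
  proof -
    have "N $ r $ j = 0" if "r \<noteq> inv \<pi> j" for r j
      using column[OF that] by (simp add: permutes_inverses(1)[OF \<pi>])
    thus ?thesis by (auto simp: vec_eq_iff monomial_matrix_def c_def)
  qed
  have "c k \<noteq> 0" for k
  proof -
    obtain r where "N $ r $ k \<noteq> 0" using invertible_nonzero_column[OF N] .
    thus ?thesis by (subst (asm) N_eq) (simp add: monomial_matrix_def split: if_splits)
  qed
  thus ?thesis using that permutes_inv[OF \<pi>] N_eq by blast
qed

lemma conj_stabilizer_diagonal_units:
  "conj_stabilizer (range diagonal_unit)
     = {monomial_matrix \<sigma> c :: 'a::field^'n::finite^'n | \<sigma> c. \<sigma> permutes UNIV \<and> (\<forall>k. c k \<noteq> 0)}"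
  using conj_stabilizer_diagonal_units_monomial monomial_matrix_in_conj_stabilizer by blast

section \<open>Fibers and vertical vectors\<close>

lemma fiber_mult_conj_stabilizer:
  assumes P: "P \<in> fiber Oc O0" and M: "M \<in> conj_stabilizer O0"
  shows "P ** M \<in> fiber Oc O0"
proof -
  have P': "invertible P" "(\<lambda>a. matrix_inv P ** a ** P) ` Oc = O0" and M': "invertible M"
    using P M unfolding fiber_def conj_stabilizer_def by auto
  have "(\<lambda>a. matrix_inv (P ** M) ** a ** (P ** M)) ` Oc
      = (\<lambda>a. matrix_inv M ** a ** M) ` (\<lambda>a. matrix_inv P ** a ** P) ` Oc"
    by (simp add: image_image matrix_inv_mult[OF P'(1) M'] matrix_mul_assoc)
  also have "\<dots> = O0"
    using P'(2) M unfolding conj_stabilizer_def by simp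
  finally show ?thesis
    unfolding fiber_def using invertible_mult[OF P'(1) M'] by blast
qed

lemma fiber_quotient_conj_stabilizer:
  assumes V: "V \<in> fiber Oc O0" and W: "W \<in> fiber Oc O0"
  shows "matrix_inv V ** W \<in> conj_stabilizer O0"
proof -
  have V': "invertible V" "(\<lambda>a. matrix_inv V ** a ** V) ` Oc = O0"
    and W': "invertible W" "(\<lambda>a. matrix_inv W ** a ** W) ` Oc = O0"
    using V W unfolding fiber_def by auto
  have inv: "matrix_inv (matrix_inv V ** W) = matrix_inv W ** V"
  proof (rule matrix_inv_unique)
    have "matrix_inv V ** W ** (matrix_inv W ** V) = matrix_inv V ** (W ** matrix_inv W) ** V"
      by (simp only: matrix_mul_assoc)
    thus "matrix_inv V ** W ** (matrix_inv W ** V) = mat 1"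
      by (simp add: matrix_inv_right[OF W'(1)] matrix_inv_left[OF V'(1)])
  qed
  have conj: "matrix_inv W ** V ** (matrix_inv V ** a ** V) ** (matrix_inv V ** W) = matrix_inv W ** a ** W" for a
    by (simp add: matrix_mul_assoc matrix_inv_right[OF V'(1)])
      (simp add: matrix_mul_assoc[symmetric] matrix_inv_right[OF V'(1)])
  have "(\<lambda>a. matrix_inv (matrix_inv V ** W) ** a ** (matrix_inv V ** W)) ` O0
      = (\<lambda>a. matrix_inv W ** a ** W) ` Oc"
    unfolding V'(2)[symmetric] image_image inv conj ..
  thus ?thesis
    unfolding conj_stabilizer_def using W'(2) invertible_mult[OF invertible_matrix_inv[OF V'(1)] W'(1)]
    by simp
qed

lemma vertical_mult_curve:
  assumes P: "P \<in> fiber Oc O0" and "\<epsilon> > 0"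
    and H: "\<And>s. s \<in> {-\<epsilon><..<\<epsilon>} \<Longrightarrow> H s \<in> conj_stabilizer O0"
    and H': "(H has_vector_derivative D) (at 0)"
  shows "vertical O0 (P ** H 0) (P ** D)"
  unfolding vertical_def
proof (intro exI conjI ballI)
  show "(\<lambda>s. P ** H s) s \<in> fiber Oc O0" if "s \<in> {-\<epsilon><..<\<epsilon>}" for s
    using fiber_mult_conj_stabilizer[OF P H[OF that]] .
  thus "P ** H 0 \<in> fiber Oc O0" using \<open>\<epsilon> > 0\<close> by simp
  show "((\<lambda>s. P ** H s) has_vector_derivative P ** D) (at 0)"
    by (rule bounded_linear.has_vector_derivative[OF
          bounded_bilinear.bounded_linear_right[OF bounded_bilinear_matrix_mult] H'])
qed (use \<open>\<epsilon> > 0\<close> in auto)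

section \<open>Coordinates adapted to a complete decomposition\<close>

locale complete_decomposition =
  fixes e es :: "'n::finite \<Rightarrow> complex^'n"
  assumes cd_family: "is_cd_family e es"
begin

abbreviation O0 :: "'n op set" where
  "O0 \<equiv> range (\<lambda>k. ketbra (e k) (es k))"

definition basis_matrix :: "'n op" where
  "basis_matrix = (\<chi> i k. e k $ i)"

definition dual_basis_matrix :: "'n op" where
  "dual_basis_matrix = (\<chi> k i. cnj (es k $ i))"

definition of_coords :: "'n op \<Rightarrow> 'n op" where
  "of_coords M = basis_matrix ** M ** dual_basis_matrix"

definition coords :: "'n op \<Rightarrow> 'n op" where
  "coords M = dual_basis_matrix ** M ** basis_matrix"

lemma basis_mult_dual: "basis_matrix ** dual_basis_matrix = mat 1"
  using cd_family unfolding is_cd_family_def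
  by (simp add: vec_eq_iff basis_matrix_def dual_basis_matrix_def matrix_matrix_mult_def ketbra_def)

lemma dual_mult_basis: "dual_basis_matrix ** basis_matrix = mat 1"
  using cd_family unfolding is_cd_family_def
  by (simp add: vec_eq_iff basis_matrix_def dual_basis_matrix_def matrix_matrix_mult_def braket_def mat_def)

lemma of_coords_mult: "of_coords A ** of_coords B = of_coords (A ** B)"
  unfolding of_coords_def
  by (simp add: matrix_mul_assoc) (simp add: matrix_mul_assoc[symmetric] dual_mult_basis)

lemma of_coords_one: "of_coords (mat 1) = mat 1"
  by (simp add: of_coords_def basis_mult_dual)

lemma of_coords_coords: "of_coords (coords M) = M"
  unfolding of_coords_def coords_def
  by (simp add: matrix_mul_assoc) (simp add: matrix_mul_assoc[symmetric] basis_mult_dual)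

lemma coords_of_coords: "coords (of_coords A) = A"
  unfolding of_coords_def coords_def
  by (simp add: matrix_mul_assoc) (simp add: matrix_mul_assoc[symmetric] dual_mult_basis)

lemma inj_of_coords: "inj of_coords"
  by (metis injI coords_of_coords)

lemma invertible_of_coords: "invertible (of_coords A) \<longleftrightarrow> invertible A"
  by (metis invertible_right_inverse coords_of_coords of_coords_coords of_coords_mult of_coords_one)

lemma matrix_inv_of_coords: "invertible A \<Longrightarrow> matrix_inv (of_coords A) = of_coords (matrix_inv A)"
  by (simp add: matrix_inv_unique of_coords_mult matrix_inv_right of_coords_one)

lemma bounded_linear_of_coords: "bounded_linear of_coords"
  and bounded_linear_coords: "bounded_linear coords"
  unfolding of_coords_def[abs_def] coords_def[abs_def]
  by (intro bounded_linear_compose[OF bounded_bilinear.bounded_linear_left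
        bounded_bilinear.bounded_linear_right] bounded_bilinear_matrix_mult)+

lemmas of_coords_add = linear_add[OF bounded_linear.linear[OF bounded_linear_of_coords]]
  and of_coords_zero = linear_0[OF bounded_linear.linear[OF bounded_linear_of_coords]]

lemma conj_stabilizer_of_coords_image:
  "conj_stabilizer (of_coords ` S) = of_coords ` conj_stabilizer S"
proof -
  have conj: "matrix_inv (of_coords N) ** of_coords a ** of_coords N = of_coords (matrix_inv N ** a ** N)"
    if "invertible N" for N a
    by (simp add: matrix_inv_of_coords[OF that] of_coords_mult)
  have "of_coords N \<in> conj_stabilizer (of_coords ` S) \<longleftrightarrow> N \<in> conj_stabilizer S" for N
  proof (cases "invertible N")
    case True
    have "(\<lambda>a. matrix_inv (of_coords N) ** a ** of_coords N) ` of_coords ` S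
        = of_coords ` (\<lambda>a. matrix_inv N ** a ** N) ` S"
      by (simp add: image_image conj[OF True])
    thus ?thesis
      unfolding conj_stabilizer_def using inj_image_eq_iff[OF inj_of_coords] True
      by (simp add: invertible_of_coords)
  qed (simp add: conj_stabilizer_def invertible_of_coords)
  thus ?thesis by (metis (no_types, lifting) image_iff subsetI subset_antisym of_coords_coords)
qed

lemma of_coords_monomial_matrix:
  "of_coords (monomial_matrix \<sigma> c) = (\<Sum>k\<in>UNIV. cscale (c k) (ketbra (e (\<sigma> k)) (es k)))"
proof -
  have "(basis_matrix ** monomial_matrix \<sigma> c) $ i $ l = e (\<sigma> l) $ i * c l" for i l
    by (simp add: matrix_mult_monomial_matrix_nth basis_matrix_def)
  thus ?thesis
    unfolding of_coords_def matrix_matrix_mult_def[of "basis_matrix ** monomial_matrix \<sigma> c"]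
    by (simp add: vec_eq_iff dual_basis_matrix_def cscale_def ketbra_def ac_simps)
qed

lemma of_coords_diagonal_unit: "of_coords (diagonal_unit k) = ketbra (e k) (es k)"
proof -
  have "(\<Sum>j\<in>UNIV. cscale (of_bool (j = k)) (ketbra (e j) (es j))) = cscale 1 (ketbra (e k) (es k))"
    by (simp add: cscale_def vec_eq_iff if_distrib[of "\<lambda>c. c * _"] cong: if_cong)
  thus ?thesis by (simp add: of_coords_monomial_matrix cscale_def)
qed

lemma O0_eq: "O0 = of_coords ` range diagonal_unit"
  by (simp add: image_image of_coords_diagonal_unit)

lemma GO_eq: "GO e es = of_coords ` {monomial_matrix \<sigma> c | \<sigma> c. \<sigma> permutes UNIV \<and> (\<forall>k. c k \<noteq> 0)}"
  unfolding GO_def of_coords_monomial_matrix[symmetric] by blast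

lemma GO_eq_conj_stabilizer: "GO e es = conj_stabilizer O0"
  unfolding O0_eq conj_stabilizer_of_coords_image conj_stabilizer_diagonal_units GO_eq ..

lemma gO_eq: "gO e es = range (\<lambda>\<alpha>. of_coords (diagonal_matrix \<alpha>))"
proof -
  have "of_coords (diagonal_matrix \<alpha>) = (\<Sum>k\<in>UNIV. cscale (\<alpha> k) (ketbra (e k) (es k)))" for \<alpha>
    by (simp add: of_coords_monomial_matrix)
  thus ?thesis unfolding gO_def by auto
qed

lemma vertical_mult_diagonal:
  assumes P: "P \<in> fiber Oc O0"
  shows "vertical O0 P (P ** of_coords (diagonal_matrix \<beta>))"
proof -
  define H where "H s = of_coords (diagonal_matrix (\<lambda>k. exp (of_real s * \<beta> k)))" for s :: real
  have "H s \<in> conj_stabilizer O0" for s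
    unfolding H_def GO_eq_conj_stabilizer[symmetric] GO_eq
    by (intro imageI CollectI exI[of _ id] exI[of _ "\<lambda>k. exp (of_real s * \<beta> k)"]) (simp add: permutes_id)
  moreover have "(H has_vector_derivative of_coords (diagonal_matrix \<beta>)) (at 0)"
  proof -
    have "((\<lambda>z. exp (z * \<beta> k)) has_field_derivative \<beta> k) (at (of_real 0))" for k
      by (auto intro!: derivative_eq_intros)
    hence "((\<lambda>s. exp (of_real s * \<beta> k)) has_vector_derivative \<beta> k) (at 0)" for k
      by (rule has_vector_derivative_real_field)
    thus ?thesis
      unfolding H_def
      by (intro bounded_linear.has_vector_derivative[OF bounded_linear_of_coords]
          has_vector_derivative_monomial_matrix)
  qed
  moreover have "P ** H 0 = P"
    by (simp add: H_def diagonal_matrix_one of_coords_one)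
  ultimately show ?thesis
    using vertical_mult_curve[OF P, of 1 H] by auto
qed

end

section \<open>Connections and horizontal lifts\<close>

locale connection = complete_decomposition e es for e es :: "'n::finite \<Rightarrow> complex^'n" +
  fixes \<Omega> :: "'n op \<Rightarrow> 'n op \<Rightarrow> 'n op"
  assumes is_connection: "is_connection e es \<Omega>"
begin

lemma connection_in_gO: "invertible P \<Longrightarrow> \<Omega> P Q \<in> gO e es"
  and connection_add: "invertible P \<Longrightarrow> \<Omega> P (Q + R) = \<Omega> P Q + \<Omega> P R"
  and connection_vertical: "invertible P \<Longrightarrow> vertical O0 P Q \<Longrightarrow> \<Omega> P Q = matrix_inv P ** Q"
  and connection_equivariant:
    "G \<in> GO e es \<Longrightarrow> invertible P \<Longrightarrow> \<Omega> (P ** G) (Q ** G) = matrix_inv G ** \<Omega> P Q ** G"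
  and connection_tendsto: "(\<And>n. invertible (Ps n)) \<Longrightarrow> invertible P \<Longrightarrow> Ps \<longlonglongrightarrow> P \<Longrightarrow> Qs \<longlonglongrightarrow> Q \<Longrightarrow>
    (\<lambda>n. \<Omega> (Ps n) (Qs n)) \<longlonglongrightarrow> \<Omega> P Q"
  using is_connection unfolding is_connection_def invops_def by blast+

lemma continuous_on_connection:
  fixes P Q :: "real \<Rightarrow> 'n op"
  assumes "continuous_on S P" "continuous_on S Q" "\<And>t. t \<in> S \<Longrightarrow> invertible (P t)"
  shows "continuous_on S (\<lambda>t. \<Omega> (P t) (Q t))"
proof (rule continuous_on_sequentiallyI)
  fix u a assume u: "\<forall>n. u n \<in> S" "a \<in> S" "u \<longlonglongrightarrow> a"
  hence "(\<lambda>n. P (u n)) \<longlonglongrightarrow> P a" "(\<lambda>n. Q (u n)) \<longlonglongrightarrow> Q a"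
    using assms(1,2) continuous_on_sequentially[of S P] continuous_on_sequentially[of S Q]
    by (auto simp: o_def)
  thus "(\<lambda>n. \<Omega> (P (u n)) (Q (u n))) \<longlonglongrightarrow> \<Omega> (P a) (Q a)"
    using u assms(3) by (intro connection_tendsto) auto
qed

lemma connection_product_rule:
  assumes P: "P \<in> fiber Oc O0" and G: "G \<in> GO e es"
    and vert: "vertical O0 (P ** G) (P ** G')"
  shows "\<Omega> (P ** G) (P ** G' + P' ** G) = matrix_inv G ** G' + matrix_inv G ** \<Omega> P P' ** G"
proof -
  have "invertible P" "invertible G"
    using P G unfolding fiber_def GO_eq_conj_stabilizer conj_stabilizer_def by auto
  hence PG: "invertible (P ** G)" by (rule invertible_mult)
  have "\<Omega> (P ** G) (P ** G') = matrix_inv G ** G'"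
    using connection_vertical[OF PG vert] \<open>invertible P\<close> \<open>invertible G\<close>
    by (simp add: matrix_inv_mult matrix_mul_assoc) (simp add: matrix_mul_assoc[symmetric] matrix_inv_left)
  thus ?thesis
    using connection_add[OF PG] connection_equivariant[OF G \<open>invertible P\<close>] by simp
qed

lemma connection_form_diagonal:
  fixes V V' :: "real \<Rightarrow> 'n op"
  assumes "continuous_on S V" "continuous_on S V'" "\<And>t. t \<in> S \<Longrightarrow> invertible (V t)"
  obtains \<alpha> where "\<And>k. continuous_on S (\<lambda>t. \<alpha> t k)"
    "\<And>t. t \<in> S \<Longrightarrow> \<Omega> (V t) (V' t) = of_coords (diagonal_matrix (\<alpha> t))"
proof
  define \<alpha> where "\<alpha> t k = coords (\<Omega> (V t) (V' t)) $ k $ k" for t k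
  show "continuous_on S (\<lambda>t. \<alpha> t k)" for k
    unfolding \<alpha>_def
    by (intro continuous_intros bounded_linear.continuous_on[OF bounded_linear_coords]
        continuous_on_connection assms)
  show "\<Omega> (V t) (V' t) = of_coords (diagonal_matrix (\<alpha> t))" if t: "t \<in> S" for t
  proof -
    obtain \<beta> where \<beta>: "\<Omega> (V t) (V' t) = of_coords (diagonal_matrix \<beta>)"
      using connection_in_gO[OF assms(3)[OF t]] unfolding gO_eq by blast
    hence "\<alpha> t = \<beta>"
      by (simp add: \<alpha>_def fun_eq_iff coords_of_coords monomial_matrix_def)
    thus ?thesis using \<beta> by simp
  qed
qed

lemma connection_gauge_cancel:
  assumes P: "P \<in> fiber Oc O0" and \<sigma>: "\<sigma> permutes UNIV" and g: "\<forall>k. g k \<noteq> 0"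
    and A: "\<Omega> P P' = of_coords (diagonal_matrix \<alpha>)"
  defines "G \<equiv> of_coords (monomial_matrix \<sigma> g)"
  shows "\<Omega> (P ** G) (P ** (G ** of_coords (diagonal_matrix (\<lambda>k. - \<alpha> (\<sigma> k)))) + P' ** G) = 0"
proof -
  let ?D = "of_coords (diagonal_matrix (\<lambda>k. - \<alpha> (\<sigma> k)))"
  have G: "G \<in> GO e es" unfolding G_def GO_eq using \<sigma> g by blast
  have inv: "invertible (monomial_matrix \<sigma> g)" by (rule invertible_monomial_matrix[OF \<sigma> g])
  have "vertical O0 (P ** G) ((P ** G) ** ?D)"
    by (rule vertical_mult_diagonal[OF fiber_mult_conj_stabilizer[OF P]])
      (use G GO_eq_conj_stabilizer in simp)
  hence "\<Omega> (P ** G) (P ** (G ** ?D) + P' ** G) = matrix_inv G ** (G ** ?D) + matrix_inv G ** \<Omega> P P' ** G"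
    by (intro connection_product_rule[OF P G]) (simp add: matrix_mul_assoc)
  also have "\<dots> = of_coords (diagonal_matrix (\<lambda>k. - \<alpha> (\<sigma> k)) + diagonal_matrix (\<alpha> \<circ> \<sigma>))"
  proof -
    have "matrix_inv G ** (G ** ?D) = ?D"
      using inv by (simp add: G_def matrix_inv_of_coords of_coords_mult matrix_mul_assoc matrix_inv_left of_coords_one)
    moreover have "matrix_inv G ** \<Omega> P P' ** G = of_coords (diagonal_matrix (\<alpha> \<circ> \<sigma>))"
      by (simp add: A G_def matrix_inv_of_coords[OF inv] of_coords_mult monomial_matrix_conj_diagonal[OF \<sigma> g])
    ultimately show ?thesis
      by (simp add: of_coords_add)
  qed
  also have "\<dots> = 0"
    by (simp add: monomial_matrix_add monomial_matrix_zero of_coords_zero)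
  finally show ?thesis .
qed

lemma horizontal_lift_exists:
  assumes \<tau>: "0 < \<tau>" and V: "is_smooth_lift O0 \<tau> Oc V" and V0: "V0 \<in> fiber (Oc 0) O0"
  shows "\<exists>W. is_horizontal_lift e es \<Omega> \<tau> Oc W \<and> W 0 = V0"
proof -
  let ?I = "{0..\<tau>}"
  obtain V' where V_cont: "continuous_on ?I V" and V_fib: "\<And>t. t \<in> ?I \<Longrightarrow> V t \<in> fiber (Oc t) O0"
    and V_der: "\<And>t. t \<in> ?I \<Longrightarrow> (V has_vector_derivative V' t) (at t within ?I)"
    and V'_cont: "continuous_on ?I V'"
    using V unfolding is_smooth_lift_def is_lift_def by blast
  have V_inv: "invertible (V t)" if "t \<in> ?I" for t
    using V_fib[OF that] unfolding fiber_def by blast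
  obtain \<alpha> where \<alpha>_cont: "\<And>k. continuous_on ?I (\<lambda>t. \<alpha> t k)"
    and A: "\<And>t. t \<in> ?I \<Longrightarrow> \<Omega> (V t) (V' t) = of_coords (diagonal_matrix (\<alpha> t))"
    using connection_form_diagonal[OF V_cont V'_cont V_inv] by blast
  obtain \<sigma> c where \<sigma>: "\<sigma> permutes UNIV" and c: "\<forall>k. c k \<noteq> 0"
    and G0: "matrix_inv (V 0) ** V0 = of_coords (monomial_matrix \<sigma> c)"
    using fiber_quotient_conj_stabilizer[OF V_fib V0] \<tau>
    unfolding GO_eq_conj_stabilizer[symmetric] GO_eq by auto
  define g where "g t k = c k * exp (integral {0..t} (\<lambda>s. - \<alpha> s (\<sigma> k)))" for t k
  define G where "G t = of_coords (monomial_matrix \<sigma> (g t))" for t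
  define D where "D t = of_coords (diagonal_matrix (\<lambda>k. - \<alpha> t (\<sigma> k)))" for t
  have g_nonzero: "\<forall>k. g t k \<noteq> 0" for t
    using c by (simp add: g_def)
  have G_der: "(G has_vector_derivative G t ** D t) (at t within ?I)" if "t \<in> ?I" for t
  proof -
    have "((\<lambda>t. g t k) has_vector_derivative - \<alpha> t (\<sigma> k) * g t k) (at t within ?I)" for k
      unfolding g_def by (intro has_vector_derivative_exp_integral continuous_intros \<alpha>_cont that)
    hence "(G has_vector_derivative of_coords (monomial_matrix \<sigma> (\<lambda>k. - \<alpha> t (\<sigma> k) * g t k))) (at t within ?I)"
      unfolding G_def
      by (intro bounded_linear.has_vector_derivative[OF bounded_linear_of_coords]
          has_vector_derivative_monomial_matrix)
    thus ?thesis
      by (simp add: G_def D_def of_coords_mult monomial_matrix_mult mult.commute)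
  qed
  have G_stab: "G t \<in> conj_stabilizer O0" for t
    unfolding G_def GO_eq_conj_stabilizer[symmetric] GO_eq using \<sigma> g_nonzero by blast
  define W where "W t = V t ** G t" for t
  define W' where "W' t = V t ** (G t ** D t) + V' t ** G t" for t
  have W_der: "(W has_vector_derivative W' t) (at t within ?I)" if "t \<in> ?I" for t
    unfolding W_def W'_def by (rule has_vector_derivative_matrix_mult[OF V_der[OF that] G_der[OF that]])
  have "is_smooth_lift O0 \<tau> Oc W"
    unfolding is_smooth_lift_def is_lift_def
  proof (intro conjI exI ballI)
    show "continuous_on ?I W" using W_der by (intro continuous_on_vector_derivative) blast
    show "W t \<in> fiber (Oc t) O0" if "t \<in> ?I" for t
      unfolding W_def by (rule fiber_mult_conj_stabilizer[OF V_fib[OF that] G_stab])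
    have "continuous_on ?I G" using G_der by (intro continuous_on_vector_derivative) blast
    thus "continuous_on ?I W'"
      unfolding W'_def D_def
      by (intro continuous_intros continuous_on_matrix_mult V_cont V'_cont
          bounded_linear.continuous_on[OF bounded_linear_of_coords] continuous_on_monomial_matrix \<alpha>_cont)
  qed (rule W_der)
  moreover have "\<Omega> (W t) (vector_derivative W (at t within ?I)) = 0" if "t \<in> ?I" for t
    using vector_derivative_within_closed_interval[OF \<tau> that W_der[OF that]]
      connection_gauge_cancel[OF V_fib[OF that] \<sigma> g_nonzero A[OF that]]
    by (simp add: W_def W'_def G_def D_def)
  moreover have "W 0 = V0"
  proof -
    have "g 0 = c" by (simp add: g_def fun_eq_iff)
    hence "W 0 = V 0 ** (matrix_inv (V 0) ** V0)" by (simp add: W_def G_def G0)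
    thus ?thesis using V_inv[of 0] \<tau> by (simp add: matrix_mul_assoc matrix_inv_right)
  qed
  ultimately show ?thesis
    unfolding is_horizontal_lift_def by blast
qed

lemma horizontal_liftE:
  assumes \<tau>: "0 < \<tau>" and V: "is_horizontal_lift e es \<Omega> \<tau> Oc V"
  obtains V' where "\<And>t. t \<in> {0..\<tau>} \<Longrightarrow> V t \<in> fiber (Oc t) O0"
    "\<And>t. t \<in> {0..\<tau>} \<Longrightarrow> (V has_vector_derivative V' t) (at t within {0..\<tau>})"
    "\<And>t. t \<in> {0..\<tau>} \<Longrightarrow> \<Omega> (V t) (V' t) = 0"
proof -
  obtain V' where V': "\<And>t. t \<in> {0..\<tau>} \<Longrightarrow> (V has_vector_derivative V' t) (at t within {0..\<tau>})"
    using V unfolding is_horizontal_lift_def is_smooth_lift_def by blast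
  show thesis
  proof (rule that)
    show "V t \<in> fiber (Oc t) O0" if "t \<in> {0..\<tau>}" for t
      using V that unfolding is_horizontal_lift_def is_smooth_lift_def is_lift_def by blast
    show "\<Omega> (V t) (V' t) = 0" if "t \<in> {0..\<tau>}" for t
      using V that vector_derivative_within_closed_interval[OF \<tau> that V'[OF that]]
      unfolding is_horizontal_lift_def by metis
  qed (rule V')
qed

lemma gauge_derivative_vanishes:
  assumes P: "P \<in> fiber Oc O0" and hor: "\<Omega> P P' = 0" and "\<epsilon> > 0"
    and H: "\<And>s. s \<in> {-\<epsilon><..<\<epsilon>} \<Longrightarrow> H s \<in> conj_stabilizer O0"
    and H': "(H has_vector_derivative H') (at 0)"
    and PH_hor: "\<Omega> (P ** H 0) (P ** H' + P' ** H 0) = 0"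
  shows "H' = 0"
proof -
  have H0: "H 0 \<in> GO e es" "invertible (H 0)"
    using H[of 0] \<open>\<epsilon> > 0\<close> unfolding GO_eq_conj_stabilizer conj_stabilizer_def by auto
  have "vertical O0 (P ** H 0) (P ** H')"
    by (rule vertical_mult_curve[OF P \<open>\<epsilon> > 0\<close> H H'])
  hence "matrix_inv (H 0) ** H' = 0"
    using connection_product_rule[OF P H0(1)] PH_hor hor by simp
  moreover have "H' = H 0 ** (matrix_inv (H 0) ** H')"
    by (simp add: matrix_mul_assoc matrix_inv_right[OF H0(2)])
  ultimately show ?thesis by simp
qed

lemma horizontal_lift_unique:
  assumes \<tau>: "0 < \<tau>" and V: "is_horizontal_lift e es \<Omega> \<tau> Oc V" and W: "is_horizontal_lift e es \<Omega> \<tau> Oc W"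
    and init: "W 0 = V 0" and t: "t \<in> {0..\<tau>}"
  shows "W t = V t"
proof -
  let ?I = "{0..\<tau>}"
  obtain V' where V_fib: "\<And>t. t \<in> ?I \<Longrightarrow> V t \<in> fiber (Oc t) O0"
    and V_der: "\<And>t. t \<in> ?I \<Longrightarrow> (V has_vector_derivative V' t) (at t within ?I)"
    and V_hor: "\<And>t. t \<in> ?I \<Longrightarrow> \<Omega> (V t) (V' t) = 0"
    using horizontal_liftE[OF \<tau> V] by blast
  obtain W' where W_fib: "\<And>t. t \<in> ?I \<Longrightarrow> W t \<in> fiber (Oc t) O0"
    and W_der: "\<And>t. t \<in> ?I \<Longrightarrow> (W has_vector_derivative W' t) (at t within ?I)"
    and W_hor: "\<And>t. t \<in> ?I \<Longrightarrow> \<Omega> (W t) (W' t) = 0"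
    using horizontal_liftE[OF \<tau> W] by blast
  have V_inv: "invertible (V t)" if "t \<in> ?I" for t
    using V_fib[OF that] unfolding fiber_def by blast
  define H where "H t = matrix_inv (V t) ** W t" for t
  define H' where "H' t = matrix_inv (V t) ** W' t + - (matrix_inv (V t) ** V' t ** matrix_inv (V t)) ** W t" for t
  have H_der: "(H has_vector_derivative H' t) (at t within ?I)" if "t \<in> ?I" for t
    unfolding H_def H'_def
    by (rule has_vector_derivative_matrix_mult[OF
          has_vector_derivative_matrix_inv[OF V_der[OF that] V_inv[OF that]] W_der[OF that]])
  have VH: "V t ** H t = W t" if "t \<in> ?I" for t
    unfolding H_def by (simp add: matrix_mul_assoc matrix_inv_right[OF V_inv[OF that]])
  \<comment> \<open>Verticality needs a curve on both sides of \<open>t\<close>, so \<open>H' = 0\<close> is only derived at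
      interior points; the end points form the finite exception set below.\<close>
  have H'_zero: "H' t = 0" if t: "t \<in> {0<..<\<tau>}" for t
  proof -
    have tI: "t \<in> ?I" using t by simp
    have "((\<lambda>s. V s ** H s) has_vector_derivative V t ** H' t + V' t ** H t) (at t within ?I)"
      by (rule has_vector_derivative_matrix_mult[OF V_der[OF tI] H_der[OF tI]])
    hence "(W has_vector_derivative V t ** H' t + V' t ** H t) (at t within ?I)"
      by (rule has_vector_derivative_transform[OF tI, rotated]) (simp add: VH)
    hence W': "W' t = V t ** H' t + V' t ** H t"
      using vector_derivative_within_closed_interval[OF \<tau> tI] W_der[OF tI] by metis
    show ?thesis
    proof (rule gauge_derivative_vanishes[OF V_fib[OF tI] V_hor[OF tI]])
      show "min t (\<tau> - t) > 0" using t by simp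
      show "H (t + s) \<in> conj_stabilizer O0" if "s \<in> {- min t (\<tau> - t)<..<min t (\<tau> - t)}" for s
        unfolding H_def using that
        by (intro fiber_quotient_conj_stabilizer[OF V_fib W_fib]) auto
      show "((\<lambda>s. H (t + s)) has_vector_derivative H' t) (at 0)"
        by (rule has_vector_derivative_shift_at_0[OF H_der[OF tI] t])
      show "\<Omega> (V t ** H (t + 0)) (V t ** H' t + V' t ** H (t + 0)) = 0"
        using W_hor[OF tI] by (simp add: W' VH[OF tI])
    qed
  qed
  have "H t = mat 1"
  proof (rule has_derivative_zero_unique_strong_interval[of "{0, \<tau>}" 0 \<tau> H])
    show "continuous_on ?I H" using H_der by (intro continuous_on_vector_derivative) blast
    show "H 0 = mat 1" using \<tau> by (simp add: H_def init matrix_inv_left V_inv)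
    show "(H has_derivative (\<lambda>h. 0)) (at x within ?I)" if "x \<in> ?I - {0, \<tau>}" for x
      using H_der[of x] H'_zero[of x] that by (simp add: has_vector_derivative_def)
  qed (use t in simp_all)
  thus ?thesis using VH[OF t] by simp
qed

end

theorem proposition7p14:
  fixes e es :: "'n::finite \<Rightarrow> complex^'n"
    and \<Omega> :: "'n op \<Rightarrow> 'n op \<Rightarrow> 'n op"
    and Oc :: "real \<Rightarrow> 'n op set"
    and \<tau> :: real and V0 :: "'n op"
  assumes O0: "is_cd_family e es"
    and conn: "is_connection e es \<Omega>"
    and tau: "0 < \<tau>"
    and curve: "\<forall>t\<in>{0..\<tau>}. Oc t \<in> complete_decomps"
    and smooth: "\<exists>V. is_smooth_lift (range (\<lambda>k. ketbra (e k) (es k))) \<tau> Oc V"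
    and V0: "V0 \<in> fiber (Oc 0) (range (\<lambda>k. ketbra (e k) (es k)))"
  shows "\<exists>V. is_horizontal_lift e es \<Omega> \<tau> Oc V \<and> V 0 = V0 \<and>
           (\<forall>W. is_horizontal_lift e es \<Omega> \<tau> Oc W \<and> W 0 = V0 \<longrightarrow> (\<forall>t\<in>{0..\<tau>}. W t = V t))"
proof -
  interpret connection e es \<Omega>
    by (intro connection.intro complete_decomposition.intro connection_axioms.intro O0 conn)
  from smooth obtain V' where "is_smooth_lift O0 \<tau> Oc V'" by blast
  from horizontal_lift_exists[OF tau this V0]
  obtain V where "is_horizontal_lift e es \<Omega> \<tau> Oc V" "V 0 = V0" by blast
  thus ?thesis
    using horizontal_lift_unique[OF tau] by metis
qed

end
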